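(* Let $0<\alpha<1$ and let $p\ge 1$, $q\ge 1$ with $1/p+1/q\le 1+\alpha$, where moreover $p\ne 1$ and $q\ne 1$ in the case $1/p+1/q=1+\alpha$. If $f\in L^p([a,b],\mathbb{R})$ and $g^*\in L^q([a,b],\mathbb{R})$, then $$\int_a^b f(\tau)\cdot\left(\mathcal{I}^{\alpha}_{b-}g\right)^*(\tau)\,d\tau=\int_a^b\left(\mathcal{I}^{\alpha}_{b-}f\right)(\tau)\cdot g^*(\tau)\,d\tau .$$
   Context: For $f:[a,b]\to\mathbb{R}$ the dual function is $f^*(t)=f(b-t+a)$, $t\in[a,b]$. For $\alpha>0$ the right fractional integral of order $\alpha$ of $\varphi\in L^1([a,b],\mathbb{R})$ is $(\mathcal{I}^{\alpha}_{b-}\varphi)(t)=\frac{1}{\Gamma(\alpha)}\int_t^b\varphi(\tau)(\tau-t)^{\alpha-1}d\tau$, $t<b$. *)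

theory Defs
  imports "HOL-Analysis.Analysis"
begin

text \<open>
  Elements of \<open>L\<^sup>p([a,b], \<real>)\<close> are handled through representatives: functions on \<open>\<real>\<close>
  of which only the values on \<open>[a,b]\<close> matter. The exponent \<open>p\<close> is a finite real.
\<close>

definition Lp_space :: "real \<Rightarrow> real \<Rightarrow> real \<Rightarrow> (real \<Rightarrow> real) set" where
  "Lp_space p a b =
    {f. set_borel_measurable lebesgue {a..b} f \<and>
        set_integrable lebesgue {a..b} (\<lambda>t. \<bar>f t\<bar> powr p)}"

definition dual_fun :: "real \<Rightarrow> real \<Rightarrow> (real \<Rightarrow> real) \<Rightarrow> real \<Rightarrow> real" where
  "dual_fun a b f t = f (b - t + a)"

text \<open>
  For \<open>\<phi> \<in> L\<^sup>1([a,b], \<real>)\<close> the integral exists for almost every \<open>t \<in> [a,b]\<close>; at the exceptional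
  points the Bochner integral is \<open>0\<close> by convention.
\<close>

definition right_frac_integral :: "real \<Rightarrow> real \<Rightarrow> (real \<Rightarrow> real) \<Rightarrow> real \<Rightarrow> real" where
  "right_frac_integral \<alpha> b \<phi> t =
    1 / Gamma \<alpha> * (LINT \<tau>:{t..b}|lebesgue. \<phi> \<tau> * (\<tau> - t) powr (\<alpha> - 1))"

end

(* Both integrals are iterated integrals of f(x) g*(y) (x - y)^(\<alpha>-1) over a <= y <= x <= b, so the
   point is absolute integrability. In the critical case 1/p + 1/q = 1 + \<alpha>, p, q > 1
   (Hardy-Littlewood-Sobolev), split the square according to whether |g*(y)|^q <= |f(x)|^p or not. On the
   first part put s = |f(x)| and r = s^(-p): for |x - y| <= r use |g*(y)| <= s^(p/q), for |x - y| >= r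
   use Young's inequality; both parts contribute at most a constant times s^p, which is integrable.
   The second part is symmetric. If 1/p + 1/q < 1 + \<alpha> and p, q > 1, the exponents can be lowered to the
   critical case because [a,b] is bounded; if p = 1 or q = 1, Young's inequality alone suffices. *)
theory Submission
  imports Defs
begin

section \<open>Sigma-finiteness and measurability for Lebesgue measure\<close>

text \<open>Completion does not change the measure of Borel sets, so a countable cover that works
  for \<open>lborel\<close> works here too. Tonelli and Fubini for \<open>lebesgue\<close> rest on
  this.\<close>

lemma sigma_finite_lebesgue: "sigma_finite_measure (lebesgue :: 'a::euclidean_space measure)"
proof -
  obtain A :: "'a set set" where A: "countable A" "A \<subseteq> sets lborel" "\<Union>A = space lborel"
      "\<forall>a\<in>A. emeasure lborel a \<noteq> \<infinity>"
    using sigma_finite_measure.sigma_finite_countable[OF sigma_finite_lborel] by blast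
  then show ?thesis
    by (intro sigma_finite_measure.intro exI[of _ A]) (auto simp: subset_eq)
qed

lemma pair_sigma_finite_lebesgue:
  "pair_sigma_finite (lebesgue :: 'a::euclidean_space measure) (lebesgue :: 'b::euclidean_space measure)"
  by (simp add: pair_sigma_finite_def sigma_finite_lebesgue)

lemma measurable_ident_lebesgue_borel [measurable]:
  "(\<lambda>x. x) \<in> lebesgue \<rightarrow>\<^sub>M (borel :: 'a::euclidean_space measure)"
  by (rule measurable_completion) simp

section \<open>Integrals of radial kernels on the line\<close>

text \<open>Translate \<open>y\<close> to centre the kernel at 0, then bound the even function
  \<open>h \<bar>t\<bar>\<close> by \<open>h t + h (- t)\<close>; each summand integrates to
  \<open>I\<close>. The set \<open>\<Omega>\<close> is a parameter so that a neighbourhood of 0 and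
  a neighbourhood of infinity are both covered.\<close>

lemma nn_integral_abs_diff_le:
  fixes \<phi> :: "real \<Rightarrow> real" and x :: real
  assumes [measurable]: "\<phi> \<in> borel_measurable borel"
    and \<phi>: "\<And>t. 0 \<le> t \<Longrightarrow> t \<in> \<Omega> \<Longrightarrow> 0 \<le> \<phi> t" "(\<phi> has_integral I) \<Omega>"
    and \<Omega>: "\<Omega> \<subseteq> {0..}" "\<Omega> \<in> sets borel"
  shows "(\<integral>\<^sup>+ y. ennreal (indicator \<Omega> \<bar>x - y\<bar> * \<phi> \<bar>x - y\<bar>) \<partial>lebesgue) \<le> ennreal (2 * I)"
proof -
  note [measurable] = \<Omega>(2)
  define h where "h t = ennreal (indicator \<Omega> t * \<phi> t)" for t
  have [measurable]: "h \<in> borel_measurable borel"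
    unfolding h_def by measurable
  have I: "(\<integral>\<^sup>+ t. h t \<partial>lborel) = ennreal I"
    unfolding h_def using \<phi> \<Omega> by (intro nn_integral_has_integral_lebesgue) auto
  have I': "(\<integral>\<^sup>+ t. h (- t) \<partial>lborel) = ennreal I"
    using nn_integral_real_affine[of h "-1" 0] I by simp
  have "I \<ge> 0"
    using \<phi> \<Omega> by (intro has_integral_nonneg[of \<phi> I \<Omega>]) auto
  have "(\<integral>\<^sup>+ y. h \<bar>x - y\<bar> \<partial>lebesgue) = (\<integral>\<^sup>+ y. h \<bar>x - y\<bar> \<partial>lborel)"
    by (simp add: nn_integral_completion)
  also have "\<dots> = (\<integral>\<^sup>+ t. h \<bar>t\<bar> \<partial>lborel)"
    using nn_integral_real_affine[of "\<lambda>y. h \<bar>x - y\<bar>" 1 x] by simp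
  also have "\<dots> \<le> (\<integral>\<^sup>+ t. h t + h (- t) \<partial>lborel)"
    by (intro nn_integral_mono) (auto simp: abs_if)
  also have "\<dots> = ennreal I + ennreal I"
    by (subst nn_integral_add) (auto simp: I I')
  also have "\<dots> = ennreal (2 * I)"
    using \<open>I \<ge> 0\<close> by (simp flip: ennreal_plus)
  finally show ?thesis
    by (simp add: h_def)
qed

lemma nn_integral_abs_diff_powr_near:
  assumes "\<beta> > -1" "r \<ge> 0"
  shows "(\<integral>\<^sup>+ y. ennreal (indicator {0..r} \<bar>x - y\<bar> * \<bar>x - y\<bar> powr \<beta>) \<partial>lebesgue)
           \<le> ennreal (2 * r powr (\<beta> + 1) / (\<beta> + 1))"
  using nn_integral_abs_diff_le[OF _ _ has_integral_powr_from_0[OF assms], of x] by auto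

lemma nn_integral_abs_diff_powr_far:
  assumes "\<beta> < -1" "r > 0"
  shows "(\<integral>\<^sup>+ y. ennreal (indicator {r..} \<bar>x - y\<bar> * \<bar>x - y\<bar> powr \<beta>) \<partial>lebesgue)
           \<le> ennreal (2 * r powr (\<beta> + 1) / (- \<beta> - 1))"
proof -
  have "2 * (- (r powr (\<beta> + 1)) / (\<beta> + 1)) = 2 * r powr (\<beta> + 1) / (- \<beta> - 1)"
    using assms by (simp add: field_simps)
  then show ?thesis
    using nn_integral_abs_diff_le[OF _ _ has_integral_powr_to_inf[OF assms], of x] assms by auto
qed

section \<open>The critical case 1/p + 1/q = 1 + \<alpha>\<close>

text \<open>Young's inequality with its weights \<open>1 / q\<close> and \<open>1 - 1 / q\<close>
  bounded by 1; only finiteness is at stake later, so constants may be generous.\<close>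

lemma mult_le_powr_add_powr_conjugate:
  fixes x y q :: real
  assumes "x \<ge> 0" "y \<ge> 0" "q > 1"
  shows "x * y \<le> x powr q + y powr (q / (q - 1))"
proof -
  have "x * y \<le> x powr q / q + y powr (q / (q - 1)) / (q / (q - 1))"
    using assms by (intro Youngs_inequality) (auto simp: field_simps)
  also have "\<dots> \<le> x powr q + y powr (q / (q - 1))"
    using assms by (intro add_mono divide_left_mono[of 1 _ "_ powr _", simplified]) auto
  finally show ?thesis .
qed

text \<open>The inner integral at a fixed \<open>x\<close>, with \<open>s\<close> in the role of
  \<open>u x\<close>. What matters is that the bound is \<open>s powr p\<close> times a factor free
  of \<open>s\<close> and \<open>x\<close>: it can then be integrated over \<open>x\<close>. The two
  fractions are the constants of the near and the far part.\<close>

lemma nn_integral_kernel_le: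
  fixes v :: "real \<Rightarrow> real"
  assumes \<alpha>: "0 < \<alpha>" "\<alpha> < 1" and pq: "p > 1" "q > 1" "1 / p + 1 / q = 1 + \<alpha>"
    and v: "v \<in> borel_measurable lebesgue" "\<And>y. v y \<ge> 0" and "s \<ge> 0"
  shows "(\<integral>\<^sup>+ y. ennreal (if v y powr q \<le> s powr p then s * v y * \<bar>x - y\<bar> powr (\<alpha> - 1) else 0) \<partial>lebesgue)
    \<le> ennreal (s powr p) * (ennreal (2 / \<alpha> + 2 / (- ((\<alpha> - 1) * (q / (q - 1))) - 1))
          + (\<integral>\<^sup>+ y. ennreal (v y powr q) \<partial>lebesgue))"
proof (cases "s = 0")
  case True
  then show ?thesis by (simp add: if_distrib cong: if_cong)
next
  case False
  with \<open>s \<ge> 0\<close> have s: "s > 0" by simp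
  note [measurable] = v(1)
  define q' where "q' = q / (q - 1)"
  define \<beta> where "\<beta> = (\<alpha> - 1) * q'"
  \<comment> \<open>This radius balances the two parts: by \<open>e1\<close> and \<open>e2\<close>
    below, near and far contributions both scale exactly like \<open>s powr p\<close>.\<close>
  define r where "r = s powr (- p)"
  have r: "r > 0" using s by (simp add: r_def)
  \<comment> \<open>The critical relation between the exponents, rewritten with the conjugate
    exponent of \<open>q\<close>; it makes the powers of \<open>s\<close> cancel in
    \<open>e2\<close>.\<close>
  have q': "q' * (1 - p * \<alpha>) = p"
  proof -
    have "1 - p * \<alpha> = p * (q - 1) / q" using pq by (simp add: field_simps)
    then show ?thesis using pq by (simp add: q'_def)
  qed
  \<comment> \<open>As \<open>p > 1\<close>, the critical relation gives
    \<open>\<alpha> < 1 / q\<close>. This is equivalent to \<open>\<beta> < -1\<close>, so the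
    kernel raised to the power \<open>q'\<close> is integrable at infinity.\<close>
  have "\<alpha> * q < 1"
  proof -
    have "\<alpha> < 1 / q" using pq by (smt (verit) divide_less_eq_1)
    then show ?thesis using pq by (simp add: field_simps)
  qed
  then have \<beta>: "\<beta> < -1"
    using pq by (simp add: \<beta>_def q'_def field_simps)
  have e1: "s * s powr (p / q) * r powr \<alpha> = s powr p"
  proof -
    have "s * s powr (p / q) * r powr \<alpha> = s powr (1 + p / q - p * \<alpha>)"
      unfolding r_def powr_powr using s by (simp add: powr_add powr_diff powr_minus_divide)
    also have "1 + p / q - p * \<alpha> = p"
      using pq by (simp add: field_simps)
    finally show ?thesis .
  qed
  have e2: "(s powr (1 - p)) powr q' * r powr (\<beta> + 1) = 1"
  proof -
    have "(s powr (1 - p)) powr q' * r powr (\<beta> + 1) = s powr ((1 - p) * q' - p * (\<beta> + 1))"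
      using s by (simp add: r_def powr_powr flip: powr_add)
    also have "(1 - p) * q' - p * (\<beta> + 1) = 0"
      using q' by (simp add: \<beta>_def algebra_simps)
    finally show ?thesis using s by simp
  qed
  let ?near = "\<lambda>y. indicator {0..r} \<bar>x - y\<bar> * \<bar>x - y\<bar> powr (\<alpha> - 1)"
  let ?far = "\<lambda>y. indicator {r..} \<bar>x - y\<bar> * \<bar>x - y\<bar> powr \<beta>"
  have pw: "(if v y powr q \<le> s powr p then s * v y * \<bar>x - y\<bar> powr (\<alpha> - 1) else 0)
      \<le> s * s powr (p / q) * ?near y
        + (s powr p * v y powr q + s powr p * (s powr (1 - p)) powr q' * ?far y)" (is "?l \<le> ?r")
    for y
  proof (cases "v y powr q \<le> s powr p")
    case vs: True
    show ?thesis
    proof (cases "\<bar>x - y\<bar> \<le> r")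
      case True
      have "v y = (v y powr q) powr (1 / q)"
        using v(2)[of y] pq by (simp add: powr_powr)
      also have "\<dots> \<le> (s powr p) powr (1 / q)"
        using vs pq by (intro powr_mono2) auto
      finally have "v y \<le> s powr (p / q)"
        by (simp add: powr_powr)
      then have "?l \<le> s * s powr (p / q) * ?near y"
        using True vs s by (auto intro!: mult_right_mono mult_left_mono)
      also have "\<dots> \<le> ?r"
        by auto
      finally show ?thesis .
    next
      case False
      \<comment> \<open>Writing \<open>s\<close> as \<open>s powr p * s powr (1 - p)\<close> before
        applying Young's inequality gives the term \<open>v y powr q\<close> the coefficient
        \<open>s powr p\<close>.\<close>
      have "s * v y * \<bar>x - y\<bar> powr (\<alpha> - 1)
          = s powr p * (v y * (s powr (1 - p) * \<bar>x - y\<bar> powr (\<alpha> - 1)))"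
        using s by (simp add: powr_diff field_simps)
      also have "\<dots> \<le> s powr p * (v y powr q + (s powr (1 - p) * \<bar>x - y\<bar> powr (\<alpha> - 1)) powr q')"
        unfolding q'_def using v(2) pq
        by (intro mult_left_mono mult_le_powr_add_powr_conjugate) auto
      also have "\<dots> = s powr p * v y powr q + s powr p * (s powr (1 - p)) powr q' * ?far y"
        using False by (simp add: powr_mult powr_powr \<beta>_def algebra_simps)
      also have "\<dots> \<le> ?r"
        using s by auto
      finally show ?thesis using vs by simp
    qed
  qed (use s in auto)
  have nn_integral_lin: "(\<integral>\<^sup>+ y. c * f y + (d * g y + e * h y) \<partial>lebesgue)
      = c * integral\<^sup>N lebesgue f + (d * integral\<^sup>N lebesgue g + e * integral\<^sup>N lebesgue h)"
    if [measurable]: "f \<in> borel_measurable lebesgue" "g \<in> borel_measurable lebesgue" "h \<in> borel_measurable lebesgue"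
    for c d e and f g h :: "real \<Rightarrow> ennreal"
    by (simp add: nn_integral_add nn_integral_cmult)
  have ennreal_factor: "ennreal (c * d) + (ennreal c * X + ennreal (c * e)) = ennreal c * (ennreal (d + e) + X)"
    if "c \<ge> 0" "d \<ge> 0" "e \<ge> 0" for c d e :: real and X
    using that by (simp add: ennreal_mult distrib_left ac_simps)
  have ennreal_lin: "ennreal (c * k + (d * l + e * m))
      = ennreal c * ennreal k + (ennreal d * ennreal l + ennreal e * ennreal m)"
    if "c \<ge> 0" "k \<ge> 0" "d \<ge> 0" "l \<ge> 0" "e \<ge> 0" "m \<ge> 0" for c d e k l m :: real
    using that by (simp add: ennreal_mult)
  have "(\<integral>\<^sup>+ y. ennreal (if v y powr q \<le> s powr p then s * v y * \<bar>x - y\<bar> powr (\<alpha> - 1) else 0) \<partial>lebesgue)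
    \<le> (\<integral>\<^sup>+ y. ennreal (s * s powr (p / q)) * ennreal (?near y) +
        (ennreal (s powr p) * ennreal (v y powr q)
          + ennreal (s powr p * (s powr (1 - p)) powr q') * ennreal (?far y)) \<partial>lebesgue)"
  proof (rule nn_integral_mono)
    fix y
    show "ennreal (if v y powr q \<le> s powr p then s * v y * \<bar>x - y\<bar> powr (\<alpha> - 1) else 0)
        \<le> ennreal (s * s powr (p / q)) * ennreal (?near y) + (ennreal (s powr p) * ennreal (v y powr q)
          + ennreal (s powr p * (s powr (1 - p)) powr q') * ennreal (?far y))"
      by (subst ennreal_lin[symmetric]) (use s ennreal_leI[OF pw] in simp_all)
  qed
  also have "\<dots> = ennreal (s * s powr (p / q)) * (\<integral>\<^sup>+ y. ?near y \<partial>lebesgue) +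
        (ennreal (s powr p) * (\<integral>\<^sup>+ y. v y powr q \<partial>lebesgue)
          + ennreal (s powr p * (s powr (1 - p)) powr q') * (\<integral>\<^sup>+ y. ?far y \<partial>lebesgue))"
    by (rule nn_integral_lin) measurable
  \<comment> \<open>The near kernel has exponent \<open>\<alpha> - 1 > -1\<close> and the far kernel
    has exponent \<open>\<beta> < -1\<close>, so each is integrable on its side of the
    radius.\<close>
  also have "\<dots> \<le> ennreal (s * s powr (p / q)) * ennreal (2 * r powr \<alpha> / \<alpha>) +
        (ennreal (s powr p) * (\<integral>\<^sup>+ y. v y powr q \<partial>lebesgue)
          + ennreal (s powr p * (s powr (1 - p)) powr q') * ennreal (2 * r powr (\<beta> + 1) / (- \<beta> - 1)))"
    using nn_integral_abs_diff_powr_near[of "\<alpha> - 1" r x] nn_integral_abs_diff_powr_far[OF \<beta> r, of x] \<alpha> r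
    by (intro add_mono mult_left_mono) auto
  also have "ennreal (s * s powr (p / q)) * ennreal (2 * r powr \<alpha> / \<alpha>) = ennreal (s powr p * (2 / \<alpha>))"
    using s \<alpha> e1 by (simp flip: ennreal_mult e1 add: field_simps)
  also have "ennreal (s powr p * (s powr (1 - p)) powr q') * ennreal (2 * r powr (\<beta> + 1) / (- \<beta> - 1))
      = ennreal (s powr p * (2 / (- \<beta> - 1)))"
  proof -
    have "s powr p * (s powr (1 - p)) powr q' * (2 * r powr (\<beta> + 1) / (- \<beta> - 1))
        = s powr p * ((s powr (1 - p)) powr q' * r powr (\<beta> + 1)) * (2 / (- \<beta> - 1))"
      by simp
    then show ?thesis
      unfolding e2 using \<beta> by (simp flip: ennreal_mult)
  qed
  also have "ennreal (s powr p * (2 / \<alpha>)) +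
        (ennreal (s powr p) * (\<integral>\<^sup>+ y. v y powr q \<partial>lebesgue) + ennreal (s powr p * (2 / (- \<beta> - 1))))
      = ennreal (s powr p) * (ennreal (2 / \<alpha> + 2 / (- \<beta> - 1)) + (\<integral>\<^sup>+ y. v y powr q \<partial>lebesgue))"
    by (rule ennreal_factor) (use \<alpha> \<beta> in auto)
  finally show ?thesis
    by (simp add: \<beta>_def q'_def)
qed

text \<open>The qualitative form of the Hardy-Littlewood-Sobolev inequality, finiteness without a
  norm estimate. The plane is split according to which of \<open>u x powr p\<close> and
  \<open>v y powr q\<close> is larger, and the variable of the larger one is integrated
  last.\<close>

lemma hardy_littlewood_sobolev_finite:
  fixes u v :: "real \<Rightarrow> real"
  assumes \<alpha>: "0 < \<alpha>" "\<alpha> < 1" and pq: "p > 1" "q > 1" "1 / p + 1 / q = 1 + \<alpha>"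
    and u: "u \<in> borel_measurable lebesgue" "\<And>y. u y \<ge> 0" "(\<integral>\<^sup>+ x. ennreal (u x powr p) \<partial>lebesgue) < \<infinity>"
    and v: "v \<in> borel_measurable lebesgue" "\<And>y. v y \<ge> 0" "(\<integral>\<^sup>+ x. ennreal (v x powr q) \<partial>lebesgue) < \<infinity>"
  shows "(\<integral>\<^sup>+ x. \<integral>\<^sup>+ y. ennreal (u x * v y * \<bar>x - y\<bar> powr (\<alpha> - 1)) \<partial>lebesgue \<partial>lebesgue) < \<infinity>"
proof -
  interpret pair_sigma_finite "lebesgue :: real measure" "lebesgue :: real measure"
    by (rule pair_sigma_finite_lebesgue)
  note [measurable] = u(1) v(1)
  let ?U = "\<lambda>x y. ennreal (if v y powr q \<le> u x powr p then u x * v y * \<bar>x - y\<bar> powr (\<alpha> - 1) else 0)"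
  let ?V = "\<lambda>x y. ennreal (if u x powr p \<le> v y powr q then v y * u x * \<bar>y - x\<bar> powr (\<alpha> - 1) else 0)"
  \<comment> \<open>Stated for arbitrary functions and exponents, since it is used a second time
    with the roles of \<open>u\<close>, \<open>p\<close> and \<open>v\<close>, \<open>q\<close>
    exchanged.\<close>
  have half: "(\<integral>\<^sup>+ x. \<integral>\<^sup>+ y.
      ennreal (if v y powr q \<le> u x powr p then u x * v y * \<bar>x - y\<bar> powr (\<alpha> - 1) else 0) \<partial>lebesgue \<partial>lebesgue) < \<infinity>"
    if pq: "p > 1" "q > 1" "1 / p + 1 / q = 1 + \<alpha>"
    and u: "u \<in> borel_measurable lebesgue" "\<And>y. u y \<ge> 0" "(\<integral>\<^sup>+ x. ennreal (u x powr p) \<partial>lebesgue) < \<infinity>"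
    and v: "v \<in> borel_measurable lebesgue" "\<And>y. v y \<ge> 0" "(\<integral>\<^sup>+ x. ennreal (v x powr q) \<partial>lebesgue) < \<infinity>"
    for u v :: "real \<Rightarrow> real" and p q
  proof -
    note [measurable] = u(1) v(1)
    let ?C = "ennreal (2 / \<alpha> + 2 / (- ((\<alpha> - 1) * (q / (q - 1))) - 1))
          + (\<integral>\<^sup>+ y. ennreal (v y powr q) \<partial>lebesgue)"
    have "(\<integral>\<^sup>+ x. \<integral>\<^sup>+ y. ennreal (if v y powr q \<le> u x powr p then u x * v y * \<bar>x - y\<bar> powr (\<alpha> - 1) else 0)
        \<partial>lebesgue \<partial>lebesgue) \<le> (\<integral>\<^sup>+ x. ennreal (u x powr p) * ?C \<partial>lebesgue)"
      by (intro nn_integral_mono nn_integral_kernel_le \<alpha> pq v u)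
    also have "\<dots> = (\<integral>\<^sup>+ x. ennreal (u x powr p) \<partial>lebesgue) * ?C"
      by (rule nn_integral_multc) measurable
    also have "\<dots> < \<infinity>"
      using u v by (simp add: ennreal_mult_less_top)
    finally show ?thesis .
  qed
  \<comment> \<open>At every point at least one of the two conditions holds. Where both hold the
    integrand is counted twice, hence an inequality.\<close>
  have "(\<integral>\<^sup>+ x. \<integral>\<^sup>+ y. ennreal (u x * v y * \<bar>x - y\<bar> powr (\<alpha> - 1)) \<partial>lebesgue \<partial>lebesgue)
      \<le> (\<integral>\<^sup>+ x. \<integral>\<^sup>+ y. ?U x y + ?V x y \<partial>lebesgue \<partial>lebesgue)"
    using u(2) v(2) by (intro nn_integral_mono) (auto simp: abs_minus_commute mult.commute)
  also have "\<dots> = (\<integral>\<^sup>+ x. \<integral>\<^sup>+ y. ?U x y \<partial>lebesgue \<partial>lebesgue) + (\<integral>\<^sup>+ x. \<integral>\<^sup>+ y. ?V x y \<partial>lebesgue \<partial>lebesgue)"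
    by (simp add: nn_integral_add)
  \<comment> \<open>In \<open>?V\<close> the dominating function is \<open>v\<close>, so
    \<open>y\<close> has to become the outer variable before \<open>half\<close> applies.\<close>
  also have "(\<integral>\<^sup>+ x. \<integral>\<^sup>+ y. ?V x y \<partial>lebesgue \<partial>lebesgue) = (\<integral>\<^sup>+ y. \<integral>\<^sup>+ x. ?V x y \<partial>lebesgue \<partial>lebesgue)"
    by (rule Fubini'[symmetric]) measurable
  also have "(\<integral>\<^sup>+ x. \<integral>\<^sup>+ y. ?U x y \<partial>lebesgue \<partial>lebesgue) + (\<integral>\<^sup>+ y. \<integral>\<^sup>+ x. ?V x y \<partial>lebesgue \<partial>lebesgue) < \<infinity>"
    using half[OF pq u v] half[OF pq(2,1) _ v u] pq(3) by (simp add: add.commute)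
  finally show ?thesis .
qed

section \<open>Remaining exponents, on a bounded interval\<close>

text \<open>The condition \<open>1 / q < \<alpha>\<close> says that the kernel lies locally in the
  Lebesgue space of the exponent conjugate to \<open>q\<close>. Young's inequality then bounds the
  inner integral uniformly in \<open>x\<close>, and integrability of \<open>u\<close> does the
  rest.\<close>

lemma weakly_singular_pairing_finite_L1:
  fixes u v :: "real \<Rightarrow> real"
  assumes q: "q > 1" "1 / q < \<alpha>"
    and u: "u \<in> borel_measurable lebesgue" "\<And>y. u y \<ge> 0" "(\<integral>\<^sup>+ x. ennreal (u x) \<partial>lebesgue) < \<infinity>"
    and v: "v \<in> borel_measurable lebesgue" "\<And>y. v y \<ge> 0" "(\<integral>\<^sup>+ x. ennreal (v x powr q) \<partial>lebesgue) < \<infinity>"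
    and supp: "\<And>x. x \<notin> {a..b} \<Longrightarrow> u x = 0" "\<And>x. x \<notin> {a..b} \<Longrightarrow> v x = 0"
  shows "(\<integral>\<^sup>+ x. \<integral>\<^sup>+ y. ennreal (u x * v y * \<bar>x - y\<bar> powr (\<alpha> - 1)) \<partial>lebesgue \<partial>lebesgue) < \<infinity>"
proof -
  note [measurable] = u(1) v(1)
  define \<beta> where "\<beta> = (\<alpha> - 1) * (q / (q - 1))"
  \<comment> \<open>Two points of the interval are at most \<open>r\<close> apart, so only the near
    part of the kernel occurs. The absolute value keeps \<open>r\<close> nonnegative for all
    \<open>a\<close> and \<open>b\<close>.\<close>
  define r where "r = \<bar>b - a\<bar>"
  have \<beta>: "\<beta> > -1"
    using q by (simp add: \<beta>_def field_simps)
  let ?near = "\<lambda>x y. indicator {0..r} \<bar>x - y\<bar> * \<bar>x - y\<bar> powr \<beta>"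
  let ?C = "(\<integral>\<^sup>+ y. v y powr q \<partial>lebesgue) + ennreal (2 * r powr (\<beta> + 1) / (\<beta> + 1))"
  have pw: "u x * v y * \<bar>x - y\<bar> powr (\<alpha> - 1) \<le> u x * (v y powr q + ?near x y)" for x y
  proof (cases "x \<in> {a..b} \<and> y \<in> {a..b}")
    case True
    then have "\<bar>x - y\<bar> \<le> r" by (auto simp: r_def)
    have "v y * \<bar>x - y\<bar> powr (\<alpha> - 1) \<le> v y powr q + (\<bar>x - y\<bar> powr (\<alpha> - 1)) powr (q / (q - 1))"
      using v(2) q by (intro mult_le_powr_add_powr_conjugate) auto
    also have "\<dots> = v y powr q + ?near x y"
      using \<open>\<bar>x - y\<bar> \<le> r\<close> by (simp add: powr_powr \<beta>_def)
    finally show ?thesis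
      using u(2)[of x] by (simp add: mult.assoc mult_left_mono)
  qed (use supp u(2) in auto)
  have "(\<integral>\<^sup>+ x. \<integral>\<^sup>+ y. ennreal (u x * v y * \<bar>x - y\<bar> powr (\<alpha> - 1)) \<partial>lebesgue \<partial>lebesgue)
      \<le> (\<integral>\<^sup>+ x. \<integral>\<^sup>+ y. ennreal (u x) * (ennreal (v y powr q) + ennreal (?near x y)) \<partial>lebesgue \<partial>lebesgue)"
    using u(2) pw
    by (intro nn_integral_mono) (auto simp del: ennreal_plus simp flip: ennreal_mult ennreal_plus intro!: ennreal_leI)
  also have "\<dots> = (\<integral>\<^sup>+ x. ennreal (u x) *
      ((\<integral>\<^sup>+ y. v y powr q \<partial>lebesgue) + (\<integral>\<^sup>+ y. ?near x y \<partial>lebesgue)) \<partial>lebesgue)"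
    by (simp add: nn_integral_cmult nn_integral_add)
  also have "\<dots> \<le> (\<integral>\<^sup>+ x. ennreal (u x) * ?C \<partial>lebesgue)"
    using \<beta> by (intro nn_integral_mono mult_left_mono add_left_mono nn_integral_abs_diff_powr_near)
      (auto simp: r_def)
  also have "\<dots> = (\<integral>\<^sup>+ x. ennreal (u x) \<partial>lebesgue) * ?C"
    by (rule nn_integral_multc) measurable
  also have "\<dots> < \<infinity>"
    using u v by (simp add: ennreal_mult_less_top)
  finally show ?thesis .
qed

text \<open>On the bounded interval a lower power is at most 1 where \<open>u\<close> is at most 1,
  and at most the higher power elsewhere.\<close>

lemma nn_integral_powr_lower_exponent_finite:
  fixes u :: "real \<Rightarrow> real"
  assumes [measurable]: "u \<in> borel_measurable lebesgue" and "\<And>x. u x \<ge> 0"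
    and "(\<integral>\<^sup>+ x. ennreal (u x powr p) \<partial>lebesgue) < \<infinity>"
    and "\<And>x. x \<notin> {a..b} \<Longrightarrow> u x = 0" and p': "0 \<le> p'" "p' \<le> p"
  shows "(\<integral>\<^sup>+ x. ennreal (u x powr p') \<partial>lebesgue) < \<infinity>"
proof -
  have pw: "u x powr p' \<le> indicator {a..b} x + u x powr p" for x
  proof (cases "u x \<le> 1 \<or> x \<notin> {a..b}")
    \<comment> \<open>Outside the interval the left side is 0 even for \<open>p' = 0\<close>,
      because \<open>0 powr 0 = 0\<close>.\<close>
    case True
    then show ?thesis
      using assms(2,4)[of x] p' powr_le_one_le[of "u x"] powr_mono2[of p' "u x" 1]
      by (auto split: split_indicator intro: add_increasing2)
  next
    case False
    then show ?thesis
      using powr_mono[OF p'(2), of "u x"] by (simp add: add_increasing)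
  qed
  have "(\<integral>\<^sup>+ x. ennreal (u x powr p') \<partial>lebesgue)
      \<le> (\<integral>\<^sup>+ x. indicator {a..b} x + ennreal (u x powr p) \<partial>lebesgue)"
  proof (intro nn_integral_mono)
    fix x
    show "ennreal (u x powr p') \<le> indicator {a..b} x + ennreal (u x powr p)"
      using ennreal_leI[OF pw[of x]] by (simp add: ennreal_indicator)
  qed
  also have "\<dots> = emeasure lebesgue {a..b} + (\<integral>\<^sup>+ x. ennreal (u x powr p) \<partial>lebesgue)"
    by (subst nn_integral_add) (auto intro!: borel_measurable_indicator)
  also have "\<dots> < \<infinity>"
    using assms(3) by (simp add: emeasure_lborel_Icc_eq)
  finally show ?thesis .
qed

lemma weakly_singular_pairing_finite:
  fixes u v :: "real \<Rightarrow> real"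
  assumes \<alpha>: "0 < \<alpha>" "\<alpha> < 1" and pq: "p \<ge> 1" "q \<ge> 1" "1 / p + 1 / q \<le> 1 + \<alpha>"
      "1 / p + 1 / q = 1 + \<alpha> \<Longrightarrow> p \<noteq> 1 \<and> q \<noteq> 1"
    and u: "u \<in> borel_measurable lebesgue" "\<And>y. u y \<ge> 0" "(\<integral>\<^sup>+ x. ennreal (u x powr p) \<partial>lebesgue) < \<infinity>"
    and v: "v \<in> borel_measurable lebesgue" "\<And>y. v y \<ge> 0" "(\<integral>\<^sup>+ x. ennreal (v x powr q) \<partial>lebesgue) < \<infinity>"
    and supp: "\<And>x. x \<notin> {a..b} \<Longrightarrow> u x = 0" "\<And>x. x \<notin> {a..b} \<Longrightarrow> v x = 0"
  shows "(\<integral>\<^sup>+ x. \<integral>\<^sup>+ y. ennreal (u x * v y * \<bar>x - y\<bar> powr (\<alpha> - 1)) \<partial>lebesgue \<partial>lebesgue) < \<infinity>"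
proof -
  interpret pair_sigma_finite "lebesgue :: real measure" "lebesgue :: real measure"
    by (rule pair_sigma_finite_lebesgue)
  note [measurable] = u(1) v(1)
  consider "p = 1" | "q = 1" | "p > 1" "q > 1"
    using pq by linarith
  then show ?thesis
  proof cases
    case 1
    \<comment> \<open>With \<open>p = 1\<close> the bound on the exponents reads
      \<open>1 / q \<le> \<alpha>\<close>, and equality is the excluded endpoint.\<close>
    then have "1 / q < \<alpha>" using pq(3,4) by (cases "1 / q = \<alpha>") auto
    moreover from this have "q > 1" using \<alpha> pq(2) by (cases "q = 1") auto
    ultimately show ?thesis
      using weakly_singular_pairing_finite_L1[of q \<alpha> u v a b] u v supp 1 by simp
  next
    case 2
    then have "1 / p < \<alpha>" using pq(3,4) by (cases "1 / p = \<alpha>") auto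
    moreover from this have "p > 1" using \<alpha> pq(1) by (cases "p = 1") auto
    ultimately have "(\<integral>\<^sup>+ y. \<integral>\<^sup>+ x. ennreal (v y * u x * \<bar>y - x\<bar> powr (\<alpha> - 1)) \<partial>lebesgue \<partial>lebesgue) < \<infinity>"
      using weakly_singular_pairing_finite_L1[of p \<alpha> v u a b] u v supp 2 by simp
    also have "(\<integral>\<^sup>+ y. \<integral>\<^sup>+ x. ennreal (v y * u x * \<bar>y - x\<bar> powr (\<alpha> - 1)) \<partial>lebesgue \<partial>lebesgue)
        = (\<integral>\<^sup>+ x. \<integral>\<^sup>+ y. ennreal (v y * u x * \<bar>y - x\<bar> powr (\<alpha> - 1)) \<partial>lebesgue \<partial>lebesgue)"
      by (rule Fubini') measurable
    finally show ?thesis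
      by (simp add: mult.commute abs_minus_commute)
  next
    case 3
    \<comment> \<open>The point \<open>(1 / p, 1 / q)\<close> is moved along the segment towards
      \<open>(1, 1)\<close> until its coordinates \<open>s\<close> and \<open>t\<close> sum to
      \<open>1 + \<alpha>\<close>; \<open>l\<close> is the fraction of the segment covered. It is
      below 1 because \<open>\<alpha> < 1\<close>, so the new exponents \<open>1 / s\<close> and
      \<open>1 / t\<close> stay above 1. Increasing the reciprocals lowers the exponents.\<close>
    define l where "l = (1 + \<alpha> - 1 / p - 1 / q) / (2 - 1 / p - 1 / q)"
    have lt: "1 / p < 1" "1 / q < 1" using 3 by auto
    then have d: "2 - 1 / p - 1 / q > 0" by linarith
    have l: "0 \<le> l" "l < 1"
      using pq(3) \<alpha> d by (auto simp: l_def divide_less_eq_1)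
    have le: "l * (2 - 1 / p - 1 / q) = 1 + \<alpha> - 1 / p - 1 / q"
      using d by (simp add: l_def)
    define s where "s = 1 / p + l * (1 - 1 / p)"
    define t where "t = 1 / q + l * (1 - 1 / q)"
    have st: "1 / p \<le> s" "1 / q \<le> t"
      using l lt by (auto simp: s_def t_def)
    have "l * (1 - 1 / p) < 1 - 1 / p" "l * (1 - 1 / q) < 1 - 1 / q"
      using l lt by auto
    then have st1: "s < 1" "t < 1"
      by (auto simp: s_def t_def)
    have sum: "s + t = 1 + \<alpha>"
      using le by (simp add: s_def t_def algebra_simps)
    have pos: "s > 0" "t > 0"
      using st pq(1,2) by (smt (verit) divide_pos_pos)+
    have "1 / s \<le> p" "1 / t \<le> q"
      using st pos pq(1,2) by (auto simp: field_simps)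
    then have fin: "(\<integral>\<^sup>+ x. ennreal (u x powr (1 / s)) \<partial>lebesgue) < \<infinity>"
        "(\<integral>\<^sup>+ x. ennreal (v x powr (1 / t)) \<partial>lebesgue) < \<infinity>"
      using nn_integral_powr_lower_exponent_finite[OF u supp(1)]
        nn_integral_powr_lower_exponent_finite[OF v supp(2)] pos by auto
    show ?thesis
      using hardy_littlewood_sobolev_finite[OF \<alpha> _ _ _ u(1,2) fin(1) v(1,2) fin(2)] st1 pos sum
      by simp
  qed
qed

section \<open>Fractional integrals and the exchange of integrations\<close>

text \<open>The reflection of \<open>y\<close> to \<open>a + b - y\<close> maps
  \<open>{a..x}\<close> onto \<open>{b - x + a..b}\<close>. The result is the left Riemann-Liouville
  integral of the dual function, which gives both sides of the theorem the same kernel.\<close>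

lemma dual_right_frac_integral:
  "dual_fun a b (right_frac_integral \<alpha> b g) x
    = 1 / Gamma \<alpha> * (LINT y:{a..x}|lebesgue. dual_fun a b g y * (x - y) powr (\<alpha> - 1))"
  unfolding dual_fun_def right_frac_integral_def set_lebesgue_integral_def
  by (subst lebesgue_integral_real_affine[of "-1" _ "a + b"])
     (auto intro!: Bochner_Integration.integral_cong simp: indicator_def algebra_simps)

text \<open>Passes from set integrals to integrals over the line. Extension by zero commutes with
  the power, as \<open>0 powr p = 0\<close>.\<close>

lemma Lp_space_zero_extension:
  assumes "f \<in> Lp_space p a b"
  defines "u \<equiv> \<lambda>x. indicator {a..b} x * f x"
  shows "u \<in> borel_measurable lebesgue" "(\<integral>\<^sup>+ x. ennreal (\<bar>u x\<bar> powr p) \<partial>lebesgue) < \<infinity>"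
proof -
  show "u \<in> borel_measurable lebesgue"
    using assms by (simp add: Lp_space_def set_borel_measurable_def u_def)
  have "integrable lebesgue (\<lambda>x. indicator {a..b} x * \<bar>f x\<bar> powr p)"
    using assms by (simp add: Lp_space_def set_integrable_def)
  also have "(\<lambda>x. indicator {a..b} x * \<bar>f x\<bar> powr p) = (\<lambda>x. \<bar>u x\<bar> powr p)"
    by (auto simp: u_def indicator_def)
  finally show "(\<integral>\<^sup>+ x. ennreal (\<bar>u x\<bar> powr p) \<partial>lebesgue) < \<infinity>"
    by (simp add: integrable_iff_bounded)
qed

theorem theorem3p13:
  fixes \<alpha> p q a b :: real and f g :: "real \<Rightarrow> real"
  assumes "a < b"
    and "0 < \<alpha>" and "\<alpha> < 1"
    and "p \<ge> 1" and "q \<ge> 1"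
    and "1 / p + 1 / q \<le> 1 + \<alpha>"
    and "1 / p + 1 / q = 1 + \<alpha> \<Longrightarrow> p \<noteq> 1 \<and> q \<noteq> 1"
    and "f \<in> Lp_space p a b"
    and "dual_fun a b g \<in> Lp_space q a b"
  shows "set_integrable lebesgue {a..b}
           (\<lambda>\<tau>. f \<tau> * dual_fun a b (right_frac_integral \<alpha> b g) \<tau>) \<and>
         set_integrable lebesgue {a..b}
           (\<lambda>\<tau>. right_frac_integral \<alpha> b f \<tau> * dual_fun a b g \<tau>) \<and>
         (LINT \<tau>:{a..b}|lebesgue. f \<tau> * dual_fun a b (right_frac_integral \<alpha> b g) \<tau>) =
         (LINT \<tau>:{a..b}|lebesgue. right_frac_integral \<alpha> b f \<tau> * dual_fun a b g \<tau>)"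
proof -
  interpret pair_sigma_finite "lebesgue :: real measure" "lebesgue :: real measure"
    by (rule pair_sigma_finite_lebesgue)
  define u where "u = (\<lambda>x. indicator {a..b} x * f x)"
  define v where "v = (\<lambda>x. indicator {a..b} x * dual_fun a b g x)"
  note u = Lp_space_zero_extension[OF assms(8), folded u_def]
  note v = Lp_space_zero_extension[OF assms(9), folded v_def]
  note [measurable] = u(1) v(1)
  \<comment> \<open>The common integrand on the triangle; on the diagonal it is 0, since
    \<open>0 powr (\<alpha> - 1) = 0\<close>.\<close>
  define \<Phi> where "\<Phi> = (\<lambda>x y. if y \<le> x then u x * v y * (x - y) powr (\<alpha> - 1) else 0)"
  have [measurable]: "case_prod \<Phi> \<in> borel_measurable (lebesgue \<Otimes>\<^sub>M lebesgue)"
    unfolding \<Phi>_def by measurable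
  have "(\<integral>\<^sup>+ z. norm (case_prod \<Phi> z) \<partial>(lebesgue \<Otimes>\<^sub>M lebesgue))
      = (\<integral>\<^sup>+ x. \<integral>\<^sup>+ y. norm (\<Phi> x y) \<partial>lebesgue \<partial>lebesgue)"
    by (subst sigma_finite_measure.nn_integral_fst[OF sigma_finite_lebesgue, symmetric]) auto
  \<comment> \<open>Enlarging the triangle to the square gives the symmetric kernel of the
    finiteness lemma.\<close>
  also have "\<dots> \<le> (\<integral>\<^sup>+ x. \<integral>\<^sup>+ y. ennreal (\<bar>u x\<bar> * \<bar>v y\<bar> * \<bar>x - y\<bar> powr (\<alpha> - 1)) \<partial>lebesgue \<partial>lebesgue)"
    by (intro nn_integral_mono ennreal_leI) (auto simp: \<Phi>_def abs_mult)
  also have "\<dots> < \<infinity>"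
    using assms u v
    by (intro weakly_singular_pairing_finite[of \<alpha> p q _ _ a b]) (auto simp: u_def v_def)
  finally have int: "integrable (lebesgue \<Otimes>\<^sub>M lebesgue) (case_prod \<Phi>)"
    by (intro integrableI_bounded) auto
  \<comment> \<open>This holds at every \<open>x\<close>, also where the section is not integrable:
    constants can always be pulled out of a real Bochner integral, with the default value 0 on both
    sides.\<close>
  have inner_y: "indicator {a..b} x *\<^sub>R (f x * dual_fun a b (right_frac_integral \<alpha> b g) x)
      = 1 / Gamma \<alpha> * (\<integral>y. \<Phi> x y \<partial>lebesgue)" for x
  proof -
    have "(\<integral>y. \<Phi> x y \<partial>lebesgue) = (\<integral>y. u x * (indicator {a..x} y * (dual_fun a b g y * (x - y) powr (\<alpha> - 1))) \<partial>lebesgue)"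
      by (rule Bochner_Integration.integral_cong) (auto simp: \<Phi>_def u_def v_def indicator_def)
    then show ?thesis
      by (simp add: dual_right_frac_integral set_lebesgue_integral_def u_def)
  qed
  have inner_x: "indicator {a..b} y *\<^sub>R (right_frac_integral \<alpha> b f y * dual_fun a b g y)
      = 1 / Gamma \<alpha> * (\<integral>x. \<Phi> x y \<partial>lebesgue)" for y
  proof -
    have "(\<integral>x. \<Phi> x y \<partial>lebesgue) = (\<integral>x. v y * (indicator {y..b} x * (f x * (x - y) powr (\<alpha> - 1))) \<partial>lebesgue)"
      by (rule Bochner_Integration.integral_cong) (auto simp: \<Phi>_def u_def v_def indicator_def)
    then show ?thesis
      by (simp add: right_frac_integral_def set_lebesgue_integral_def v_def)
  qed
  show ?thesis
    \<comment> \<open>Both integrands are now marginals of \<open>\<Phi>\<close>, up to the factor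
      \<open>1 / Gamma \<alpha>\<close>; Fubini gives their integrability and the equality.\<close>
    unfolding set_integrable_def set_lebesgue_integral_def inner_x inner_y
    using integrable_fst[OF int] integrable_snd[OF int] Fubini_integral[OF int] by simp
qed

end
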